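(* Let $n\ge 2$ and $m=n-1$. Let $P_1,\dots,P_r$ be self-matched legs (with respect to $n$), all rooted at the common hub label $1$. Suppose that their non-hub label sets are pairwise disjoint and that at least one of these sets contains $0$. Form a spider tree whose hub has label $1$ by attaching the paths $P_1,\dots,P_r$ as arms at the hub, and attaching every unused non-hub label (every element of $A_n=\{0,2,3,\dots,m\}$ not occurring on any $P_i$) as a leaf adjacent to the hub. Then the resulting labeling of this spider tree is graceful.
   Context: A graceful labeling of a tree with $n$ vertices is a bijection from its vertices to $\{0,1,\dots,n-1\}$ such that the set of absolute differences of the labels of adjacent vertices equals $\{1,2,\dots,n-1\}$. A spider tree is obtained from a central hub vertex by attaching paths, called arms, at the hub. Put $m=n-1$ and $A_n=\{0,2,3,\dots,m\}$ (the non-hub labels when the hub has label $1$). Define $\tau_n:A_n\to\{1,\dots,m\}$ by $\tau_n(0)=m$ and $\tau_n(x)=x-1$ for $x\ge2$. A self-matched leg (with respect to $n$) is a rooted label path $P=(1,x_1,x_2,\dots,x_L)$ with distinct $x_i\in A_n$ such that $$\{|1-x_1|,|x_1-x_2|,\dots,|x_{L-1}-x_L|\}=\tau_n(\{x_1,\dots,x_L\}).$$ Its non-hub label set is $\{x_1,\dots,x_L\}$. Attaching $P$ as an arm at the hub means attaching a path of $L$ edges whose vertices, starting from the hub, are labeled $1,x_1,\dots,x_L$. *)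

theory Defs
  imports "Graph_Theory.Graph_Theory"
begin

text \<open>
  Finite simple graphs are symmetric loop-free digraphs (\<^locale>\<open>pair_graph\<close>), each edge being a
  pair of opposite arcs. The constant \<^const>\<open>tree\<close> is unsuitable for them: it counts
  the closed walk \<open>u, v, u\<close> along an edge as a cycle, and so excludes every symmetric graph
  that has an edge. Genuine cycles of an undirected simple graph have length at least 3.
\<close>

definition undirected_tree :: "'v pair_pre_digraph \<Rightarrow> bool" where
  "undirected_tree T \<longleftrightarrow>
     pair_graph T \<and>
     connected (with_proj T) \<and>
     (\<nexists>p. pre_digraph.cycle (with_proj T) p \<and> 3 \<le> length p)"

definition graceful_labeling :: "'v pair_pre_digraph \<Rightarrow> ('v \<Rightarrow> int) \<Rightarrow> bool" where
  "graceful_labeling T f \<longleftrightarrow>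
     undirected_tree T \<and>
     bij_betw f (pverts T) {0..int (card (pverts T)) - 1} \<and>
     {\<bar>f u - f v\<bar> | u v. (u, v) \<in> parcs T} = {1..int (card (pverts T)) - 1}"

text \<open>
  An arm is given by the list of its vertices in order of distance from the hub \<open>h\<close>, without
  the hub itself. The list \<open>zip (h # a) a\<close> consists of the arcs of the path \<open>h # a\<close>,
  directed away from the hub.
\<close>

definition spider_tree :: "'v pair_pre_digraph \<Rightarrow> 'v \<Rightarrow> 'v list list \<Rightarrow> bool" where
  "spider_tree T h arms \<longleftrightarrow>
     [] \<notin> set arms \<and>
     distinct (h # concat arms) \<and>
     pverts T = insert h (\<Union>a\<in>set arms. set a) \<and>
     parcs T = (\<Union>a\<in>set arms. set (zip (h # a) a) \<union> (set (zip (h # a) a))\<inverse>)"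

definition nonhub_labels :: "nat \<Rightarrow> int set" where
  "nonhub_labels n = insert 0 {2..int n - 1}"

text \<open>Only the values of \<open>tau n\<close> on \<open>nonhub_labels n\<close> are meaningful.\<close>

definition tau :: "nat \<Rightarrow> int \<Rightarrow> int" where
  "tau n x = (if x = 0 then int n - 1 else x - 1)"

text \<open>The list \<open>xs\<close> stands for the rooted label path \<open>1 # xs\<close>.\<close>

definition self_matched_leg :: "nat \<Rightarrow> int list \<Rightarrow> bool" where
  "self_matched_leg n xs \<longleftrightarrow>
     xs \<noteq> [] \<and> distinct xs \<and> set xs \<subseteq> nonhub_labels n \<and>
     {\<bar>x - y\<bar> | x y. (x, y) \<in> set (zip (1 # xs) xs)} = tau n ` set xs"

end

theory Submission
  imports Defs
begin

text \<open>
  Attaching an unused label as a leaf gives a self-matched leg of length 1, so every arm is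
  self-matched. Hence the edge differences are exactly the values of \<open>tau n\<close> on the non-hub
  labels, and \<open>tau n\<close> maps these onto \<open>{1..n - 1}\<close>.
\<close>

section \<open>Closed walks and acyclicity\<close>

lemma pcas_nth_fst:
  assumes "pcas u p v" "i < length p"
  shows "fst (p ! i) = (if i = 0 then u else snd (p ! (i - 1)))"
  using assms
proof (induction p arbitrary: u i)
  case (Cons e p)
  then show ?case
    by (cases i) (auto simp: nth_Cons')
qed simp

lemma pcas_last_snd: "pcas u p v \<Longrightarrow> p \<noteq> [] \<Longrightarrow> v = snd (last p)"
  by (induction p arbitrary: u) auto

text \<open>A cycle is required to have a distinct tail of visited vertices. This turns that
  condition into distinctness of the arc heads, so positions on a cycle can be compared by their
  heads.\<close>

lemma pawalk_verts_tl: "pcas u p v \<Longrightarrow> tl (pawalk_verts u p) = map snd p"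
proof (induction p arbitrary: u)
  case (Cons e p)
  then show ?case by (cases p) auto
qed simp

text \<open>A vertex of maximal rank on a cycle would have two distinct parents.\<close>

lemma no_cycle_of_ranked_parents:
  fixes G :: "'v pair_pre_digraph" and r :: "'v \<Rightarrow> nat"
  assumes arcs: "parcs G = D \<union> D\<inverse>"
    and rank: "\<And>u v. (u, v) \<in> D \<Longrightarrow> r u < r v"
    and parent: "\<And>u w v. (u, v) \<in> D \<Longrightarrow> (w, v) \<in> D \<Longrightarrow> u = w"
    and cycle: "pre_digraph.cycle (with_proj G) p"
  shows "length p < 3"
proof (rule ccontr)
  assume "\<not> length p < 3"
  then have len: "3 \<le> length p" by simp
  obtain u where p: "set p \<subseteq> parcs G" "pcas u p u" "distinct (tl (pawalk_verts u p))" "p \<noteq> []"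
    using cycle
    unfolding pre_digraph.cycle_def pre_digraph.awalk_def cas_with_proj_eq awalk_verts_with_proj_eq
    by auto
  have dist: "distinct (map snd p)"
    using p pawalk_verts_tl by metis
  \<comment> \<open>\<open>prev\<close> and \<open>nxt\<close> shift positions cyclically: since the
    walk closes up, arc 0 starts at the head of the last arc.\<close>
  define prev where "prev i = (if i = 0 then length p - 1 else i - 1)" for i
  define nxt where "nxt i = (if i = length p - 1 then 0 else i + 1)" for i
  have prev: "fst (p ! i) = snd (p ! prev i)" "prev i < length p" if "i < length p" for i
    using pcas_nth_fst[OF p(2) that] pcas_last_snd[OF p(2,4)] that p(4)
    by (auto simp: prev_def last_conv_nth)
  \<comment> \<open>The bound 3 on the length enters here: on a closed walk \<open>u, v, u\<close>
    the two neighbouring positions coincide.\<close>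
  have nxt: "nxt i < length p" "prev (nxt i) = i" "nxt i \<noteq> prev i" if "i < length p" for i
    using that len by (auto simp: nxt_def prev_def)
  let ?R = "(\<lambda>i. r (snd (p ! i))) ` {..<length p}"
  have "Max ?R \<in> ?R"
    using p(4) by (intro Max_in) auto
  then obtain i where i: "i < length p" and Max: "r (snd (p ! i)) = Max ?R"
    by auto
  have max: "r (snd (p ! j)) \<le> r (snd (p ! i))" if "j < length p" for j
    using that unfolding Max by (intro Max_ge) auto
  let ?x = "snd (p ! prev i)" and ?y = "snd (p ! i)" and ?z = "snd (p ! nxt i)"
  have "p ! i \<in> parcs G" "p ! nxt i \<in> parcs G"
    using i nxt(1)[OF i] p(1) by auto
  moreover have "p ! i = (?x, ?y)"
    using prev(1)[OF i] by (metis prod.collapse)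
  moreover have "p ! nxt i = (?y, ?z)"
    using prev(1)[OF nxt(1)[OF i]] nxt(2)[OF i] by (metis prod.collapse)
  ultimately have "(?x, ?y) \<in> D \<union> D\<inverse>" "(?y, ?z) \<in> D \<union> D\<inverse>"
    using arcs by metis+
  \<comment> \<open>\<open>?y\<close> has maximal rank on the cycle, so no arc of \<open>D\<close>
    leads from it to a cycle vertex. Both neighbours are therefore parents of
    \<open>?y\<close>.\<close>
  moreover have "(?y, ?x) \<notin> D" "(?y, ?z) \<notin> D"
    using rank max prev(2)[OF i] nxt(1)[OF i] by (meson leD)+
  ultimately have "?x = ?z"
    using parent by auto
  then have "prev i = nxt i"
    using dist prev(2)[OF i] nxt(1)[OF i] by (auto simp: distinct_conv_nth)
  then show False
    using nxt(3)[OF i] by simp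
qed

section \<open>Spiders are trees\<close>

lemma set_zip_Cons: "set (zip (h # a) a) = {((h # a) ! k, a ! k) | k. k < length a}"
  by (auto simp: set_zip)

text \<open>The hub sits at position 0 of every path \<open>h # a\<close>, while any other vertex
  occurs once in \<open>concat arms\<close>. The first conclusion makes the distance from the hub
  well defined, the second makes parents unique.\<close>

lemma spider_position_unique:
  assumes "distinct (h # concat arms)" "a \<in> set arms" "b \<in> set arms"
    and "k \<le> length a" "l \<le> length b" "(h # a) ! k = (h # b) ! l"
  shows "k = l" "k = 0 \<or> a = b"
proof -
  have h: "h \<notin> set a" "h \<notin> set b" and d: "distinct a"
    using assms(1-3) by (auto simp: distinct_concat_iff)
  have ab: "a = b" if "v \<in> set a" "v \<in> set b" for v
    using assms(1-3) that unfolding distinct.simps distinct_concat_iff by blast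
  have "k = l \<and> (k = 0 \<or> a = b)"
  proof (cases k; cases l)
    fix k' l' assume kl: "k = Suc k'" "l = Suc l'"
    then have eq: "a ! k' = b ! l'" "k' < length a" "l' < length b"
      using assms by auto
    then have "a = b"
      using ab by (metis nth_mem)
    then show ?thesis
      using eq d kl by (auto simp: nth_eq_iff_index_eq)
  qed (use assms h in \<open>auto simp: Suc_le_eq\<close>)
  then show "k = l" "k = 0 \<or> a = b" by auto
qed

lemma spider_tree_undirected_tree:
  fixes T :: "'v pair_pre_digraph"
  assumes "spider_tree T h arms"
  shows "undirected_tree T"
proof -
  have dist: "distinct (h # concat arms)"
    and verts: "pverts T = insert h (\<Union>a\<in>set arms. set a)"
    and arcs: "parcs T = (\<Union>a\<in>set arms. set (zip (h # a) a) \<union> (set (zip (h # a) a))\<inverse>)"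
    using assms by (auto simp: spider_tree_def)
  \<comment> \<open>\<open>D\<close> orients every edge away from the hub, and \<open>r\<close> is
    the distance from the hub.\<close>
  define D where "D = (\<Union>a\<in>set arms. set (zip (h # a) a))"
  define r where "r v = (THE k. \<exists>a\<in>set arms. k \<le> length a \<and> (h # a) ! k = v)" for v
  have r: "r ((h # a) ! k) = k" if "a \<in> set arms" "k \<le> length a" for a k
    unfolding r_def using that spider_position_unique(1)[OF dist] by (intro the_equality) blast+
  have parcs: "parcs T = D \<union> D\<inverse>"
    unfolding arcs D_def by auto
  have D: "\<exists>a k. a \<in> set arms \<and> k < length a \<and> u = (h # a) ! k \<and> v = (h # a) ! Suc k"
    if "(u, v) \<in> D" for u v
    using that unfolding D_def set_zip_Cons by fastforce
  have rank: "r u < r v" if uv: "(u, v) \<in> D" for u v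
  proof -
    obtain a k where "a \<in> set arms" "k < length a" "u = (h # a) ! k" "v = (h # a) ! Suc k"
      using D[OF uv] by blast
    then show ?thesis
      using r[of a k] r[of a "Suc k"] by simp
  qed
  have parent: "u = w" if uv: "(u, v) \<in> D" and wv: "(w, v) \<in> D" for u v w
  proof -
    obtain a k where a: "a \<in> set arms" "k < length a" "u = (h # a) ! k" "v = (h # a) ! Suc k"
      using D[OF uv] by blast
    obtain b l where b: "b \<in> set arms" "l < length b" "w = (h # b) ! l" "v = (h # b) ! Suc l"
      using D[OF wv] by blast
    \<comment> \<open>The common head is not at position 0, so arm and position agree, and hence so
      do the tails.\<close>
    have "Suc k = Suc l" "Suc k = 0 \<or> a = b"
      using spider_position_unique[OF dist a(1) b(1), of "Suc k" "Suc l"] a b by auto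
    then show ?thesis
      using a b by auto
  qed
  have zip_sub: "set (zip (h # a) a) \<subseteq> insert h (set a) \<times> set a" for a
    by (auto dest: set_zip_leftD set_zip_rightD)
  have "pair_graph T"
  proof
    fix e assume e: "e \<in> parcs T"
    then show "fst e \<in> pverts T" "snd e \<in> pverts T"
      unfolding verts arcs using zip_sub by fastforce+
    show "fst e \<noteq> snd e"
      using e rank unfolding parcs by (cases e) (auto dest: rank)
  next
    show "finite (pverts T)" "finite (parcs T)"
      unfolding verts arcs by auto
    show "symmetric (with_proj T)"
      unfolding symmetric_def by (auto simp: parcs intro!: symI)
  qed
  then interpret pair_graph T .
  have reach: "h \<rightarrow>\<^sup>*\<^bsub>with_proj T\<^esub> (h # a) ! k" if "a \<in> set arms" "k \<le> length a" for a k
    using that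
  proof (induction k)
    case 0
    then show ?case
      using verts by simp
  next
    case (Suc k)
    then have "((h # a) ! k, (h # a) ! Suc k) \<in> set (zip (h # a) a)"
      unfolding set_zip_Cons by auto
    then have "((h # a) ! k, (h # a) ! Suc k) \<in> parcs T"
      using Suc.prems unfolding arcs by blast
    then show ?case
      using Suc reachable_adj_trans by auto
  qed
  have reach_all: "h \<rightarrow>\<^sup>*\<^bsub>with_proj T\<^esub> v" if v: "v \<in> pverts T" for v
  proof (cases "v = h")
    case False
    then obtain a k where "a \<in> set arms" "k < length a" "v = a ! k"
      using v unfolding verts by (auto dest!: in_set_conv_nth[THEN iffD1, of v])
    then show ?thesis
      using reach[of a "Suc k"] by auto
  qed (use v in auto)
  have "connected (with_proj T)"
  proof (rule connectedI)
    fix u v assume "u \<in> pverts T" "v \<in> pverts T"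
    \<comment> \<open>By symmetry the walk from the hub to \<open>u\<close> can be reversed and
      continued to \<open>v\<close>.\<close>
    then have "u \<rightarrow>\<^sup>*\<^bsub>with_proj T\<^esub> v"
      using reachable_trans[OF symmetric_reachable'[OF reach_all[of u]] reach_all[of v]] by simp
    then show "u \<rightarrow>\<^sup>*\<^bsub>mk_symmetric (with_proj T)\<^esub> v"
      by (rule reachable_mk_symmetricI)
  qed (simp add: verts)
  moreover have "\<not> 3 \<le> length p" if "pre_digraph.cycle (with_proj T) p" for p
    using no_cycle_of_ranked_parents[where r = r, OF parcs _ _ that] rank parent by fastforce
  ultimately show ?thesis
    using \<open>pair_graph T\<close> unfolding undirected_tree_def by blast
qed

section \<open>Labels and edge differences\<close>

lemma tau_image_nonhub_labels:
  assumes "n \<ge> 2"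
  shows "tau n ` nonhub_labels n = {1..int n - 1}"
proof
  show "tau n ` nonhub_labels n \<subseteq> {1..int n - 1}"
    using assms by (auto simp: tau_def nonhub_labels_def)
  show "{1..int n - 1} \<subseteq> tau n ` nonhub_labels n"
  proof
    fix d assume d: "d \<in> {1..int n - 1}"
    show "d \<in> tau n ` nonhub_labels n"
    proof (cases "d = int n - 1")
      case True
      then show ?thesis
        by (intro image_eqI[of _ _ 0]) (auto simp: tau_def nonhub_labels_def)
    next
      case False
      then show ?thesis
        using d by (intro image_eqI[of _ _ "d + 1"]) (auto simp: tau_def nonhub_labels_def)
    qed
  qed
qed

text \<open>For \<open>x \<ge> 2\<close> the single difference is \<open>x - 1\<close>, which is
  \<open>tau n x\<close>. A leaf labelled 0 would give 1 instead of \<open>n - 1\<close>.\<close>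

lemma self_matched_leg_singleton:
  assumes "x \<in> nonhub_labels n" "x \<noteq> 0"
  shows "self_matched_leg n [x]"
  using assms by (auto simp: self_matched_leg_def tau_def nonhub_labels_def)

theorem theorem3p3:
  fixes n :: nat
    and Ps :: "int list list"
    and unused :: "int list"
    and T :: "'v pair_pre_digraph"
    and h :: 'v
    and arms :: "'v list list"
    and f :: "'v \<Rightarrow> int"
  assumes "n \<ge> 2"
    and "\<forall>P\<in>set Ps. self_matched_leg n P"
    and "\<forall>i<length Ps. \<forall>j<length Ps. i \<noteq> j \<longrightarrow> set (Ps ! i) \<inter> set (Ps ! j) = {}"
    and "\<exists>P\<in>set Ps. 0 \<in> set P"
    and "distinct unused"
    and "set unused = nonhub_labels n - (\<Union>P\<in>set Ps. set P)"
    and "spider_tree T h arms"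
    and "f h = 1"
    and "map (map f) arms = Ps @ map (\<lambda>x. [x]) unused"
  shows "graceful_labeling T f"
proof -
  have dist: "distinct (h # concat arms)"
    and verts: "pverts T = set (h # concat arms)"
    and arcs: "parcs T = (\<Union>a\<in>set arms. set (zip (h # a) a) \<union> (set (zip (h # a) a))\<inverse>)"
    using assms(7) by (auto simp: spider_tree_def)
  have legs: "self_matched_leg n (map f a)" if "a \<in> set arms" for a
  proof -
    have "map f a \<in> set (map (map f) arms)"
      using that by simp
    then consider "map f a \<in> set Ps" | x where "x \<in> set unused" "map f a = [x]"
      unfolding assms(9) by auto
    then show ?thesis
    proof cases
      case 2
      \<comment> \<open>Some leg contains 0, so 0 is never left over for a leaf.\<close>
      then have "x \<in> nonhub_labels n" "x \<noteq> 0"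
        using assms(4,6) by auto
      then show ?thesis
        using 2(2) self_matched_leg_singleton by simp
    qed (use assms(2) in blast)
  qed
  have labels: "map f (concat arms) = concat Ps @ unused"
    using arg_cong[OF assms(9), of concat] by (simp add: map_concat)
  have set_labels: "set (concat Ps @ unused) = nonhub_labels n"
    using assms(2,6) by (auto simp: self_matched_leg_def)
  have nonempty: "set P \<noteq> {}" if "P \<in> set Ps" for P
    using assms(2) that by (auto simp: self_matched_leg_def)
  have "distinct (concat Ps)"
  proof (rule distinct_concat)
    \<comment> \<open>Disjointness is assumed for distinct indices. A leg occurring twice would be
      disjoint from itself, hence empty.\<close>
    show "distinct Ps"
      unfolding distinct_conv_nth using assms(3) nonempty by (metis inf.idem nth_mem)
    show "distinct P" if "P \<in> set Ps" for P
      using assms(2) that by (simp add: self_matched_leg_def)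
    show "set P \<inter> set Q = {}" if "P \<in> set Ps" "Q \<in> set Ps" "P \<noteq> Q" for P Q
      using assms(3) that by (metis in_set_conv_nth)
  qed
  \<comment> \<open>The hub label 1 is the one value of \<open>{0..n - 1}\<close> missing from
    \<open>nonhub_labels n\<close>, so it repeats no arm label.\<close>
  then have dist_labels: "distinct (map f (h # concat arms))"
    using assms(5,6,8) set_labels unfolding list.map labels
    by (auto simp: nonhub_labels_def)
  have "f ` pverts T = insert 1 (nonhub_labels n)"
    using set_labels assms(8) unfolding verts labels[symmetric] by simp
  also have "\<dots> = {0..int n - 1}"
    using assms(1) by (auto simp: nonhub_labels_def)
  finally have bij: "bij_betw f (pverts T) {0..int n - 1}"
    using dist_labels unfolding bij_betw_def verts distinct_map by blast
  have card: "card (pverts T) = n"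
    using bij_betw_same_card[OF bij] by simp
  \<comment> \<open>Opposite arcs have the same absolute difference, so the outward arcs
    suffice.\<close>
  have "{\<bar>f u - f v\<bar> | u v. (u, v) \<in> parcs T}
      = (\<Union>a\<in>set arms. {\<bar>f u - f v\<bar> | u v. (u, v) \<in> set (zip (h # a) a)})"
    unfolding arcs by (fastforce simp: abs_minus_commute)
  also have "\<dots> = (\<Union>a\<in>set arms. {\<bar>x - y\<bar> | x y. (x, y) \<in> set (zip (1 # map f a) (map f a))})"
  proof -
    \<comment> \<open>As \<open>f h = 1\<close>, the label path \<open>1 # map f a\<close> is the
      image of \<open>h # a\<close> under \<open>f\<close>.\<close>
    have "set (zip (1 # map f a) (map f a)) = map_prod f f ` set (zip (h # a) a)" for a
      using assms(8) zip_map_map[of f "h # a" f a] by (auto simp: map_prod_def)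
    then have "{\<bar>x - y\<bar> | x y. (x, y) \<in> set (zip (1 # map f a) (map f a))}
        = {\<bar>f u - f v\<bar> | u v. (u, v) \<in> set (zip (h # a) a)}" for a
      by (auto simp: image_iff) (metis map_prod_simp)+
    then show ?thesis
      by simp
  qed
  also have "\<dots> = (\<Union>a\<in>set arms. tau n ` set (map f a))"
    using legs unfolding self_matched_leg_def by (intro SUP_cong) auto
  also have "\<dots> = tau n ` set (map f (concat arms))"
    by auto
  also have "\<dots> = {1..int n - 1}"
    unfolding labels set_labels using tau_image_nonhub_labels[OF assms(1)] .
  finally show ?thesis
    using bij card spider_tree_undirected_tree[OF assms(7)]
    unfolding graceful_labeling_def by simp
qed

end
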